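(* Let $k$ be a field of characteristic $\neq 2$, let $A=(A,\cdot)$ be a Jordan algebra over $k$, $E$ a $k$-vector space containing $A$ as a subspace, and $V$ a complement of $A$ in $E$ (i.e. $E=A\oplus V$). Then: (1) The relation $\equiv$ on extending structures (defined in the context) is an equivalence relation on the set $\mathcal{JES}(A,V)$ of all Jordan extending structures of $A$ through $V$. Denote by $\mathcal{J}_A(V,A):=\mathcal{JES}(A,V)/\equiv$ the quotient set. (2) The map $$\mathcal{J}_A(V,A)\to \mathrm{Jext}(E,A),\qquad \overline{(\triangleleft,\triangleright,f,\cdot_V)}\mapsto (A\,\natural\,V,\circ)$$ is (well defined and) bijective, where $\overline{(\triangleleft,\triangleright,f,\cdot_V)}$ is the equivalence class of $(\triangleleft,\triangleright,f,\cdot_V)$ under $\equiv$, and $(A\,\natural\,V,\circ)$ is regarded as (the class of) a Jordan algebra structure on $E$ via the linear identification $A\times V\cong E$, $(a,x)\mapsto a+x$.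
   Context: $k$ is a field of characteristic $\neq 2$; all vector spaces and (bi)linear maps are over $k$. A Jordan algebra is a vector space $A$ with a bilinear multiplication $\cdot$ that is commutative and satisfies $(a^2\cdot b)\cdot a=a^2\cdot(b\cdot a)$ for all $a,b\in A$ (no unit is assumed). An extending datum of a Jordan algebra $A$ through a vector space $V$ is a system $\Omega(A,V)=(\triangleleft,\triangleright,f,\cdot_V)$ of four bilinear maps $\triangleleft:V\times A\to V$, $\triangleright:V\times A\to A$, $f:V\times V\to A$, $\cdot_V:V\times V\to V$. Denote by $A\,\natural\,V$ the vector space $A\times V$ with the bilinear multiplication $$(a,x)\circ(b,y):=\bigl(a\cdot b+x\triangleright b+y\triangleright a+f(x,y),\; x\triangleleft b+y\triangleleft a+x\cdot_V y\bigr).$$ The datum is called a Jordan extending structure of $A$ through $V$ if $(A\,\natural\,V,\circ)$ is a Jordan algebra; in that case $A\,\natural\,V$ is called a unified product. $\mathcal{JES}(A,V)$ is the set of all Jordan extending structures of $A$ through $V$. Two Jordan extending structures $(\triangleleft,\triangleright,f,\cdot_V)$ and $(\triangleleft',\triangleright',f',\cdot_V')$ of $A$ through $V$ are equivalent, written $\equiv$, if there exist a linear map $r:V\to A$ and a linear automorphism $v\in\mathrm{Aut}_k(V)$ such that for all $a\in A$, $x,y\in V$, writing $\bar x=v^{-1}(x)$, $\bar y=v^{-1}(y)$: $$x\triangleleft' a=v(\bar x\triangleleft a),$$ $$x\triangleright' a=r(\bar x\triangleleft a)+\bar x\triangleright a-a\cdot r(\bar x),$$ $$f'(x,y)=f(\bar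 x,\bar y)+r(\bar x\cdot_V\bar y)+r(\bar x)\cdot r(\bar y)-r(\bar x\triangleleft r(\bar y))-\bar x\triangleright r(\bar y)-r(\bar y\triangleleft r(\bar x))-\bar y\triangleright r(\bar x),$$ $$x\cdot_V' y=v(\bar x\cdot_V\bar y)-v(\bar x\triangleleft r(\bar y))-v(\bar y\triangleleft r(\bar x)).$$ $\mathrm{Jext}(E,A)$ is the set of equivalence classes of Jordan algebra structures on the vector space $E$ containing $A$ as a subalgebra, where two structures $\cdot_E$, $\cdot_E'$ are equivalent if there is a Jordan algebra isomorphism $\varphi:(E,\cdot_E)\to(E,\cdot_E')$ with $\varphi(a)=a$ for all $a\in A$. *)

theory Defs
  imports "HOL-Analysis.Product_Vector" "HOL-Library.FuncSet"
begin

definition linear_on ::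
  "('k::field \<Rightarrow> 'e::ab_group_add \<Rightarrow> 'e) \<Rightarrow> 'e set \<Rightarrow> 'e set \<Rightarrow> ('e \<Rightarrow> 'e) \<Rightarrow> bool" where
  "linear_on smul S T f \<longleftrightarrow>
     f \<in> S \<rightarrow> T \<and>
     (\<forall>x\<in>S. \<forall>y\<in>S. f (x + y) = f x + f y) \<and>
     (\<forall>c. \<forall>x\<in>S. f (smul c x) = smul c (f x))"

definition bilinear_on ::
  "('k::field \<Rightarrow> 'e::ab_group_add \<Rightarrow> 'e) \<Rightarrow> 'e set \<Rightarrow> 'e set \<Rightarrow> 'e set \<Rightarrow> ('e \<Rightarrow> 'e \<Rightarrow> 'e) \<Rightarrow> bool" where
  "bilinear_on smul S T U f \<longleftrightarrow>
     (\<forall>x\<in>S. linear_on smul T U (f x)) \<and> (\<forall>y\<in>T. linear_on smul S U (\<lambda>x. f x y))"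

definition jordan_algebra_on ::
  "('k::field \<Rightarrow> 'e::ab_group_add \<Rightarrow> 'e) \<Rightarrow> 'e set \<Rightarrow> ('e \<Rightarrow> 'e \<Rightarrow> 'e) \<Rightarrow> bool" where
  "jordan_algebra_on smul S m \<longleftrightarrow>
     vector_space smul \<and> module.subspace smul S \<and> bilinear_on smul S S S m \<and>
     (\<forall>a\<in>S. \<forall>b\<in>S. m a b = m b a) \<and>
     (\<forall>a\<in>S. \<forall>b\<in>S. m (m (m a a) b) a = m (m a a) (m b a))"

definition complementary ::
  "('k::field \<Rightarrow> 'e::ab_group_add \<Rightarrow> 'e) \<Rightarrow> 'e set \<Rightarrow> 'e set \<Rightarrow> bool" where
  "complementary smul A V \<longleftrightarrow>
     module.subspace smul A \<and> module.subspace smul V \<and>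
     {a + x | a x. a \<in> A \<and> x \<in> V} = UNIV \<and> A \<inter> V = {0}"

text \<open>
  The fields stand for the maps written \<open>x \<triangleleft> a\<close>, \<open>x \<triangleright> a\<close>, \<open>f(x, y)\<close> and \<open>x \<cdot>\<^sub>V y\<close>.
\<close>

record 'e datum =
  ract :: "'e \<Rightarrow> 'e \<Rightarrow> 'e"
  lact :: "'e \<Rightarrow> 'e \<Rightarrow> 'e"
  cocycle :: "'e \<Rightarrow> 'e \<Rightarrow> 'e"
  vmult :: "'e \<Rightarrow> 'e \<Rightarrow> 'e"

text \<open>
  The maps are total functions on the ambient type; requiring them to be \<open>undefined\<close> off their
  domains makes each mathematical datum correspond to exactly one record.
\<close>

definition extending_datum ::
  "('k::field \<Rightarrow> 'e::ab_group_add \<Rightarrow> 'e) \<Rightarrow> 'e set \<Rightarrow> 'e set \<Rightarrow> 'e datum \<Rightarrow> bool" where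
  "extending_datum smul A V \<Omega> \<longleftrightarrow>
     ract \<Omega> \<in> V \<rightarrow>\<^sub>E A \<rightarrow>\<^sub>E V \<and> bilinear_on smul V A V (ract \<Omega>) \<and>
     lact \<Omega> \<in> V \<rightarrow>\<^sub>E A \<rightarrow>\<^sub>E A \<and> bilinear_on smul V A A (lact \<Omega>) \<and>
     cocycle \<Omega> \<in> V \<rightarrow>\<^sub>E V \<rightarrow>\<^sub>E A \<and> bilinear_on smul V V A (cocycle \<Omega>) \<and>
     vmult \<Omega> \<in> V \<rightarrow>\<^sub>E V \<rightarrow>\<^sub>E V \<and> bilinear_on smul V V V (vmult \<Omega>)"

definition unified_mult ::
  "('e::ab_group_add \<Rightarrow> 'e \<Rightarrow> 'e) \<Rightarrow> 'e datum \<Rightarrow> 'e \<times> 'e \<Rightarrow> 'e \<times> 'e \<Rightarrow> 'e \<times> 'e" where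
  "unified_mult mA \<Omega> = (\<lambda>(a, x) (b, y).
     (mA a b + lact \<Omega> x b + lact \<Omega> y a + cocycle \<Omega> x y,
      ract \<Omega> x b + ract \<Omega> y a + vmult \<Omega> x y))"

definition JES ::
  "('k::field \<Rightarrow> 'e::ab_group_add \<Rightarrow> 'e) \<Rightarrow> 'e set \<Rightarrow> ('e \<Rightarrow> 'e \<Rightarrow> 'e) \<Rightarrow> 'e set \<Rightarrow> 'e datum set" where
  "JES smul A mA V =
     {\<Omega>. extending_datum smul A V \<Omega> \<and>
         jordan_algebra_on (module_prod.scale smul smul) (A \<times> V) (unified_mult mA \<Omega>)}"

definition datum_equiv ::
  "('k::field \<Rightarrow> 'e::ab_group_add \<Rightarrow> 'e) \<Rightarrow> 'e set \<Rightarrow> ('e \<Rightarrow> 'e \<Rightarrow> 'e) \<Rightarrow> 'e set \<Rightarrow>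
     'e datum \<Rightarrow> 'e datum \<Rightarrow> bool" where
  "datum_equiv smul A mA V \<Omega> \<Omega>' \<longleftrightarrow>
     (\<exists>r v. linear_on smul V A r \<and> linear_on smul V V v \<and> bij_betw v V V \<and>
       (\<forall>a\<in>A. \<forall>x\<in>V. \<forall>y\<in>V.
          let x' = inv_into V v x; y' = inv_into V v y in
            ract \<Omega>' x a = v (ract \<Omega> x' a) \<and>
            lact \<Omega>' x a = r (ract \<Omega> x' a) + lact \<Omega> x' a - mA a (r x') \<and>
            cocycle \<Omega>' x y =
              cocycle \<Omega> x' y' + r (vmult \<Omega> x' y') + mA (r x') (r y')
                - r (ract \<Omega> x' (r y')) - lact \<Omega> x' (r y')
                - r (ract \<Omega> y' (r x')) - lact \<Omega> y' (r x') \<and>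
            vmult \<Omega>' x y =
              v (vmult \<Omega> x' y') - v (ract \<Omega> x' (r y')) - v (ract \<Omega> y' (r x'))))"

definition JES_rel ::
  "('k::field \<Rightarrow> 'e::ab_group_add \<Rightarrow> 'e) \<Rightarrow> 'e set \<Rightarrow> ('e \<Rightarrow> 'e \<Rightarrow> 'e) \<Rightarrow> 'e set \<Rightarrow>
     ('e datum \<times> 'e datum) set" where
  "JES_rel smul A mA V =
     {(\<Omega>, \<Omega>'). \<Omega> \<in> JES smul A mA V \<and> \<Omega>' \<in> JES smul A mA V \<and> datum_equiv smul A mA V \<Omega> \<Omega>'}"

definition JES_quotient ::
  "('k::field \<Rightarrow> 'e::ab_group_add \<Rightarrow> 'e) \<Rightarrow> 'e set \<Rightarrow> ('e \<Rightarrow> 'e \<Rightarrow> 'e) \<Rightarrow> 'e set \<Rightarrow> 'e datum set set" where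
  "JES_quotient smul A mA V = JES smul A mA V // JES_rel smul A mA V"

text \<open>The vector space \<open>E\<close> is the whole type \<open>'e\<close>.\<close>

definition jordan_structures ::
  "('k::field \<Rightarrow> 'e::ab_group_add \<Rightarrow> 'e) \<Rightarrow> 'e set \<Rightarrow> ('e \<Rightarrow> 'e \<Rightarrow> 'e) \<Rightarrow> ('e \<Rightarrow> 'e \<Rightarrow> 'e) set" where
  "jordan_structures smul A mA =
     {m. jordan_algebra_on smul UNIV m \<and> (\<forall>a\<in>A. \<forall>b\<in>A. m a b = mA a b)}"

definition jordan_isomorphism ::
  "('k::field \<Rightarrow> 'e::ab_group_add \<Rightarrow> 'e) \<Rightarrow> ('e \<Rightarrow> 'e \<Rightarrow> 'e) \<Rightarrow> ('e \<Rightarrow> 'e \<Rightarrow> 'e) \<Rightarrow> ('e \<Rightarrow> 'e) \<Rightarrow> bool" where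
  "jordan_isomorphism smul m m' \<phi> \<longleftrightarrow>
     Vector_Spaces.linear smul smul \<phi> \<and> bij \<phi> \<and> (\<forall>x y. \<phi> (m x y) = m' (\<phi> x) (\<phi> y))"

definition Jext_rel ::
  "('k::field \<Rightarrow> 'e::ab_group_add \<Rightarrow> 'e) \<Rightarrow> 'e set \<Rightarrow> ('e \<Rightarrow> 'e \<Rightarrow> 'e) \<Rightarrow>
     (('e \<Rightarrow> 'e \<Rightarrow> 'e) \<times> ('e \<Rightarrow> 'e \<Rightarrow> 'e)) set" where
  "Jext_rel smul A mA =
     {(m, m'). m \<in> jordan_structures smul A mA \<and> m' \<in> jordan_structures smul A mA \<and>
        (\<exists>\<phi>. jordan_isomorphism smul m m' \<phi> \<and> (\<forall>a\<in>A. \<phi> a = a))}"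

definition Jext ::
  "('k::field \<Rightarrow> 'e::ab_group_add \<Rightarrow> 'e) \<Rightarrow> 'e set \<Rightarrow> ('e \<Rightarrow> 'e \<Rightarrow> 'e) \<Rightarrow> ('e \<Rightarrow> 'e \<Rightarrow> 'e) set set" where
  "Jext smul A mA = jordan_structures smul A mA // Jext_rel smul A mA"

text \<open>The unified product transported to \<open>E\<close> along the bijection \<open>(a, x) \<mapsto> a + x\<close> on \<open>A \<times> V\<close>.\<close>

definition unified_structure ::
  "'e::ab_group_add set \<Rightarrow> ('e \<Rightarrow> 'e \<Rightarrow> 'e) \<Rightarrow> 'e set \<Rightarrow> 'e datum \<Rightarrow> 'e \<Rightarrow> 'e \<Rightarrow> 'e" where
  "unified_structure A mA V \<Omega> e e' =
     (let \<iota> = (\<lambda>(a, x). a + x); \<pi> = inv_into (A \<times> V) \<iota>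
      in \<iota> (unified_mult mA \<Omega> (\<pi> e) (\<pi> e')))"

definition unified_class ::
  "('k::field \<Rightarrow> 'e::ab_group_add \<Rightarrow> 'e) \<Rightarrow> 'e set \<Rightarrow> ('e \<Rightarrow> 'e \<Rightarrow> 'e) \<Rightarrow> 'e set \<Rightarrow>
     'e datum \<Rightarrow> ('e \<Rightarrow> 'e \<Rightarrow> 'e) set" where
  "unified_class smul A mA V \<Omega> = Jext_rel smul A mA `` {unified_structure A mA V \<Omega>}"

text \<open>
  The map induced on classes: \<open>the_elem\<close> picks the common value of \<open>unified_class\<close> on \<open>C\<close>, which is
  meaningful once \<open>unified_class\<close> is known to respect \<open>JES_rel\<close>.
\<close>

definition JES_to_Jext ::
  "('k::field \<Rightarrow> 'e::ab_group_add \<Rightarrow> 'e) \<Rightarrow> 'e set \<Rightarrow> ('e \<Rightarrow> 'e \<Rightarrow> 'e) \<Rightarrow> 'e set \<Rightarrow>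
     'e datum set \<Rightarrow> ('e \<Rightarrow> 'e \<Rightarrow> 'e) set" where
  "JES_to_Jext smul A mA V C = the_elem (unified_class smul A mA V ` C)"

end

theory Submission
  imports Defs
begin

text \<open>
  Since \<open>E = A \<oplus> V\<close>, an extending datum is the list of components of a multiplication on \<open>E\<close> that
  restricts to the one of \<open>A\<close>, so \<open>\<Omega> \<mapsto> A \<natural> V\<close> maps the Jordan extending structures onto the Jordan
  structures on \<open>E\<close>. A linear automorphism of \<open>E\<close> fixing \<open>A\<close> pointwise is the same as a pair
  \<open>(r, v)\<close> with \<open>\<phi>(a + x) = a + r x + v x\<close>, and multiplicativity of \<open>\<phi>\<close>, read off in components,
  is the list of identities defining \<open>\<equiv>\<close>. Hence \<open>\<equiv>\<close> is the pullback of the isomorphism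
  relation along a surjection, which gives all claims at once.
\<close>

section \<open>Quotients by a relation pulled back along a surjection\<close>

text \<open>Classes of \<open>Q\<close> are the preimages under \<open>F\<close> of classes of
  \<open>R\<close>, and surjectivity of \<open>F\<close> makes every class of \<open>R\<close>
  occur. The induced map is written with \<open>the_elem\<close>, the shape of
  \<open>JES_to_Jext\<close>, so that all four conclusions apply directly to the quotient of
  extending structures.\<close>

lemma bij_betw_quotient_pullback:
  assumes eqv: "equiv B R"
    and surj: "F ` S = B"
    and Q: "Q = {(x, y). x \<in> S \<and> y \<in> S \<and> (F x, F y) \<in> R}"
  shows "equiv S Q"
    and "(\<lambda>x. R `` {F x}) respects Q"
    and "x \<in> S \<Longrightarrow> the_elem ((\<lambda>x. R `` {F x}) ` (Q `` {x})) = R `` {F x}"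
    and "bij_betw (\<lambda>C. the_elem ((\<lambda>x. R `` {F x}) ` C)) (S // Q) (B // R)"
proof -
  have refl: "(u, u) \<in> R" if "u \<in> B" for u
    using eqv that by (meson equivE refl_onD)
  have sym: "(v, u) \<in> R" if "(u, v) \<in> R" for u v
    using eqv that by (meson equivE symD)
  have trans: "(u, w) \<in> R" if "(u, v) \<in> R" "(v, w) \<in> R" for u v w
    using eqv that by (meson equivE transD)
  have FB: "F x \<in> B" if "x \<in> S" for x
    using surj that by blast
  show eqvQ: "equiv S Q"
  proof (rule equivI)
    show "Q \<subseteq> S \<times> S" by (auto simp: Q)
    show "refl_on S Q" by (auto simp: Q refl_on_def intro: refl FB)
    show "sym Q" by (auto simp: Q sym_def intro: sym)
    show "trans Q" unfolding trans_def Q by (blast intro: trans)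
  qed
  show "(\<lambda>x. R `` {F x}) respects Q"
    using equiv_class_eq[OF eqv] by (auto simp: congruent_def Q)
  show *: "the_elem ((\<lambda>x. R `` {F x}) ` (Q `` {x})) = R `` {F x}" if "x \<in> S" for x
  proof -
    have "(\<lambda>x. R `` {F x}) ` (Q `` {x}) = {R `` {F x}}"
    proof (rule antisym)
      show "(\<lambda>x. R `` {F x}) ` (Q `` {x}) \<subseteq> {R `` {F x}}"
        using equiv_class_eq[OF eqv] by (auto simp: Q)
      \<comment> \<open>The map is constant on the class; reflexivity makes the class nonempty, so
        that its image is a singleton and \<open>the_elem\<close> has a value.\<close>
      have "(x, x) \<in> Q" using that refl[OF FB[OF that]] by (simp add: Q)
      then show "{R `` {F x}} \<subseteq> (\<lambda>x. R `` {F x}) ` (Q `` {x})" by blast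
    qed
    then show ?thesis by simp
  qed
  show "bij_betw (\<lambda>C. the_elem ((\<lambda>x. R `` {F x}) ` C)) (S // Q) (B // R)"
  proof (rule bij_betw_imageI)
    show "inj_on (\<lambda>C. the_elem ((\<lambda>x. R `` {F x}) ` C)) (S // Q)"
    proof (rule inj_onI)
      fix C D
      assume "C \<in> S // Q" "D \<in> S // Q"
        and e: "the_elem ((\<lambda>x. R `` {F x}) ` C) = the_elem ((\<lambda>x. R `` {F x}) ` D)"
      then obtain x y where x: "x \<in> S" "C = Q `` {x}" and y: "y \<in> S" "D = Q `` {y}"
        by (meson quotientE)
      then have "R `` {F x} = R `` {F y}" using e * by simp
      then have "(F x, F y) \<in> R"
        using refl[OF FB[OF y(1)]] by blast
      then have "(x, y) \<in> Q" using x y by (simp add: Q)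
      then show "C = D" using equiv_class_eq[OF eqvQ] x y by simp
    qed
    have "(\<lambda>C. the_elem ((\<lambda>x. R `` {F x}) ` C)) ` (S // Q) = (\<lambda>x. R `` {F x}) ` S"
      unfolding quotient_def by (auto simp: image_UN *)
    also have "\<dots> = B // R"
      by (auto simp: quotient_def surj[symmetric])
    finally show "(\<lambda>C. the_elem ((\<lambda>x. R `` {F x}) ` C)) ` (S // Q) = B // R" .
  qed
qed

section \<open>Linear and bilinear maps on subsets, and transport of Jordan structures\<close>

lemma bilinear_onD:
  assumes "bilinear_on smul S T U m"
  shows "x \<in> S \<Longrightarrow> y \<in> T \<Longrightarrow> m x y \<in> U"
    and "x \<in> S \<Longrightarrow> y \<in> T \<Longrightarrow> y' \<in> T \<Longrightarrow> m x (y + y') = m x y + m x y'"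
    and "x \<in> S \<Longrightarrow> x' \<in> S \<Longrightarrow> y \<in> T \<Longrightarrow> m (x + x') y = m x y + m x' y"
    and "x \<in> S \<Longrightarrow> y \<in> T \<Longrightarrow> m x (smul c y) = smul c (m x y)"
    and "x \<in> S \<Longrightarrow> y \<in> T \<Longrightarrow> m (smul c x) y = smul c (m x y)"
  using assms by (auto simp: bilinear_on_def linear_on_def)

lemma linear_onD:
  assumes "linear_on smul S T f"
  shows "x \<in> S \<Longrightarrow> f x \<in> T"
    and "x \<in> S \<Longrightarrow> y \<in> S \<Longrightarrow> f (x + y) = f x + f y"
    and "x \<in> S \<Longrightarrow> f (smul c x) = smul c (f x)"
  using assms by (auto simp: linear_on_def)

lemma bilinear_onI:
  assumes "\<And>x y. x \<in> S \<Longrightarrow> y \<in> T \<Longrightarrow> m x y \<in> U"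
    and "\<And>x y y'. x \<in> S \<Longrightarrow> y \<in> T \<Longrightarrow> y' \<in> T \<Longrightarrow> m x (y + y') = m x y + m x y'"
    and "\<And>x x' y. x \<in> S \<Longrightarrow> x' \<in> S \<Longrightarrow> y \<in> T \<Longrightarrow> m (x + x') y = m x y + m x' y"
    and "\<And>c x y. x \<in> S \<Longrightarrow> y \<in> T \<Longrightarrow> m x (smul c y) = smul c (m x y)"
    and "\<And>c x y. x \<in> S \<Longrightarrow> y \<in> T \<Longrightarrow> m (smul c x) y = smul c (m x y)"
  shows "bilinear_on smul S T U m"
  using assms by (auto simp: bilinear_on_def linear_on_def)

text \<open>Every element of \<open>T\<close> is some \<open>h x\<close>, and \<open>h\<close>
  carries sums, multiples and products along, so each law on \<open>T\<close> is the image under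
  \<open>h\<close> of the same law on \<open>S\<close>. Surjectivity of \<open>h\<close> suffices
  for this.\<close>

lemma jordan_algebra_on_transport:
  fixes h :: "'a::ab_group_add \<Rightarrow> 'b::ab_group_add" and s :: "'k::field \<Rightarrow> 'a \<Rightarrow> 'a"
  assumes J: "jordan_algebra_on s S m"
    and vs: "vector_space t" and sub: "module.subspace t T"
    and im: "h ` S = T"
    and add: "\<And>x y. x \<in> S \<Longrightarrow> y \<in> S \<Longrightarrow> h (x + y) = h x + h y"
    and scl: "\<And>c x. x \<in> S \<Longrightarrow> h (s c x) = t c (h x)"
    and mult: "\<And>x y. x \<in> S \<Longrightarrow> y \<in> S \<Longrightarrow> m' (h x) (h y) = h (m x y)"
  shows "jordan_algebra_on t T m'"
proof -
  interpret s: vector_space s using J by (simp add: jordan_algebra_on_def)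
  have S: "s.subspace S" using J by (simp add: jordan_algebra_on_def)
  note closed = s.subspace_add[OF S] s.subspace_scale[OF S]
  have bil: "bilinear_on s S S S m"
    and comm: "\<And>a b. a \<in> S \<Longrightarrow> b \<in> S \<Longrightarrow> m a b = m b a"
    and jord: "\<And>a b. a \<in> S \<Longrightarrow> b \<in> S \<Longrightarrow> m (m (m a a) b) a = m (m a a) (m b a)"
    using J by (auto simp: jordan_algebra_on_def)
  note b = bilinear_onD[OF bil]
  have bilT: "bilinear_on t T T T m'"
    by (rule bilinear_onI)
      (auto simp: im[symmetric] mult b closed add[symmetric] scl[symmetric])
  have "m' a b = m' b a" if "a \<in> T" "b \<in> T" for a b
    using that comm by (auto simp: im[symmetric] mult)
  moreover have "m' (m' (m' a a) b) a = m' (m' a a) (m' b a)" if "a \<in> T" "b \<in> T" for a b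
    using that by (auto simp: im[symmetric] mult b jord)
  ultimately show ?thesis
    unfolding jordan_algebra_on_def using vs sub bilT by blast
qed

section \<open>The decomposition of E into A and V and its projections\<close>

locale jordan_complement = vector_space smul
  for smul :: "'k::field \<Rightarrow> 'e::ab_group_add \<Rightarrow> 'e" +
  fixes A V :: "'e set" and mA :: "'e \<Rightarrow> 'e \<Rightarrow> 'e"
  assumes jordan_A: "jordan_algebra_on smul A mA"
    and compl: "complementary smul A V"
begin

lemma subspace_A: "subspace A" and subspace_V: "subspace V"
  using compl by (auto simp: complementary_def)

lemmas closed =
  subspace_add[OF subspace_A] subspace_scale[OF subspace_A] subspace_diff[OF subspace_A]
  subspace_neg[OF subspace_A] subspace_0[OF subspace_A]
  subspace_add[OF subspace_V] subspace_scale[OF subspace_V] subspace_diff[OF subspace_V]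
  subspace_neg[OF subspace_V] subspace_0[OF subspace_V]

lemma bilinear_mA: "bilinear_on smul A A A mA"
  and mA_commute: "a \<in> A \<Longrightarrow> b \<in> A \<Longrightarrow> mA a b = mA b a"
  using jordan_A by (auto simp: jordan_algebra_on_def)

text \<open>The difference of the two \<open>A\<close>-parts is also a difference of
  \<open>V\<close>-parts, hence lies in the zero intersection. Later proofs use this to read one
  equation in E as two, one in each component.\<close>

lemma decomposition_unique:
  assumes "a \<in> A" "x \<in> V" "b \<in> A" "y \<in> V" "a + x = b + y"
  shows "a = b" "x = y"
proof -
  have *: "a - b = y - x" using assms(5) by (simp add: algebra_simps)
  have "a - b \<in> A" "y - x \<in> V" using assms by (auto intro: closed)
  then have "a - b \<in> A \<inter> V" using * by simp
  moreover have "A \<inter> V = {0}" using compl by (simp add: complementary_def)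
  ultimately have "a - b = 0" by blast
  then show "a = b" "x = y" using * by auto
qed

text \<open>This names the inverse that occurs inside \<open>unified_structure\<close>, so that
  folding the definition there makes it computable.\<close>

definition split :: "'e \<Rightarrow> 'e \<times> 'e" where
  "split = inv_into (A \<times> V) (\<lambda>(a, x). a + x)"

definition projA :: "'e \<Rightarrow> 'e" where "projA e = fst (split e)"
definition projV :: "'e \<Rightarrow> 'e" where "projV e = snd (split e)"

lemma split_sum: "a \<in> A \<Longrightarrow> x \<in> V \<Longrightarrow> split (a + x) = (a, x)"
proof -
  have "inj_on (\<lambda>(a, x). a + x) (A \<times> V)"
    by (auto simp: inj_on_def dest: decomposition_unique)
  then show "a \<in> A \<Longrightarrow> x \<in> V \<Longrightarrow> split (a + x) = (a, x)"
    unfolding split_def using inv_into_f_f[of "\<lambda>(a, x). a + x" "A \<times> V" "(a, x)"] by auto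
qed

lemma proj_sum:
  "a \<in> A \<Longrightarrow> x \<in> V \<Longrightarrow> projA (a + x) = a" "a \<in> A \<Longrightarrow> x \<in> V \<Longrightarrow> projV (a + x) = x"
  by (simp_all add: projA_def projV_def split_sum)

lemma decompose:
  obtains a x where "a \<in> A" "x \<in> V" "e = a + x"
proof -
  have "e \<in> {a + x | a x. a \<in> A \<and> x \<in> V}" using compl by (simp add: complementary_def)
  then show ?thesis using that by blast
qed

lemma proj_in: "projA e \<in> A" "projV e \<in> V"
  using decompose[of e] proj_sum by metis+

lemma proj_decomp: "projA e + projV e = e"
  using decompose[of e] proj_sum by metis

lemma proj_eqI:
  assumes "a \<in> A" "x \<in> V" "e = a + x" shows "projA e = a" "projV e = x"
  using assms proj_sum by auto

lemma proj_add: "projA (e + e') = projA e + projA e'" "projV (e + e') = projV e + projV e'"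
proof -
  have "e + e' = (projA e + projA e') + (projV e + projV e')"
    by (metis proj_decomp add.assoc add.left_commute)
  then show "projA (e + e') = projA e + projA e'" "projV (e + e') = projV e + projV e'"
    by (auto intro: proj_eqI closed proj_in)
qed

lemma proj_scale: "projA (smul c e) = smul c (projA e)" "projV (smul c e) = smul c (projV e)"
proof -
  have "smul c e = smul c (projA e) + smul c (projV e)"
    by (metis proj_decomp scale_right_distrib)
  then show "projA (smul c e) = smul c (projA e)" "projV (smul c e) = smul c (projV e)"
    by (auto intro: proj_eqI closed proj_in)
qed

section \<open>The unified product as a multiplication on E\<close>

text \<open>The inverse inside \<open>unified_structure\<close> is resolved here; all later
  computations with the product use this formula on explicit sums.\<close>

lemma unified_structure_sum:
  assumes "a \<in> A" "x \<in> V" "b \<in> A" "y \<in> V"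
  shows "unified_structure A mA V \<Omega> (a + x) (b + y) =
    (mA a b + lact \<Omega> x b + lact \<Omega> y a + cocycle \<Omega> x y) +
    (ract \<Omega> x b + ract \<Omega> y a + vmult \<Omega> x y)"
  using assms
  by (simp add: unified_structure_def unified_mult_def split_def[symmetric] split_sum Let_def)

lemma extending_datumD:
  assumes "extending_datum smul A V \<Omega>"
  shows "bilinear_on smul V A V (ract \<Omega>)" "bilinear_on smul V A A (lact \<Omega>)"
    "bilinear_on smul V V A (cocycle \<Omega>)" "bilinear_on smul V V V (vmult \<Omega>)"
  using assms by (auto simp: extending_datum_def)

lemmas datum_in = extending_datumD[THEN bilinear_onD(1)]
lemmas datum_add =
  extending_datumD[THEN bilinear_onD(2)] extending_datumD[THEN bilinear_onD(3)]
lemmas mA_in = bilinear_onD(1)[OF bilinear_mA]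
lemmas mA_add = bilinear_onD(2,3)[OF bilinear_mA]

lemma mA_zero: "a \<in> A \<Longrightarrow> mA 0 a = 0" "a \<in> A \<Longrightarrow> mA a 0 = 0"
  \<comment> \<open>Homogeneity for the scalar 0 at the zero vector.\<close>
  using bilinear_onD(4)[OF bilinear_mA, of _ 0 0] bilinear_onD(5)[OF bilinear_mA, of 0 _ 0]
  by (simp_all add: closed)

lemma map_zero:
  assumes "linear_on smul V T f" shows "f 0 = 0"
  using linear_onD(3)[OF assms, of 0 0] by (simp add: closed)

lemma datum_zero:
  assumes "extending_datum smul A V \<Omega>"
  shows "a \<in> A \<Longrightarrow> ract \<Omega> 0 a = 0" "a \<in> A \<Longrightarrow> lact \<Omega> 0 a = 0"
    "x \<in> V \<Longrightarrow> ract \<Omega> x 0 = 0" "x \<in> V \<Longrightarrow> lact \<Omega> x 0 = 0"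
    "x \<in> V \<Longrightarrow> cocycle \<Omega> 0 x = 0" "x \<in> V \<Longrightarrow> vmult \<Omega> 0 x = 0"
    "x \<in> V \<Longrightarrow> cocycle \<Omega> x 0 = 0" "x \<in> V \<Longrightarrow> vmult \<Omega> x 0 = 0"
  using extending_datumD[OF assms, THEN bilinear_onD(4), of _ 0 0]
    extending_datumD[OF assms, THEN bilinear_onD(5), of 0 _ 0]
  by (simp_all add: closed)

lemma unified_structure_A:
  assumes "extending_datum smul A V \<Omega>" "a \<in> A" "b \<in> A"
  shows "unified_structure A mA V \<Omega> a b = mA a b"
  using unified_structure_sum[of a 0 b 0 \<Omega>] assms by (simp add: closed datum_zero mA_zero)

lemma vector_space_prod_scale: "vector_space (module_prod.scale smul smul)"
proof -
  interpret vs_prod: vector_space_prod smul smul ..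
  show ?thesis by (rule vs_prod.p.vector_space_axioms)
qed

lemma prod_scale: "module_prod.scale smul smul c p = (smul c (fst p), smul c (snd p))"
proof -
  interpret vs_prod: vector_space_prod smul smul ..
  show ?thesis by (simp add: vs_prod.scale_def)
qed

lemma subspace_prod: "module.subspace (module_prod.scale smul smul) (A \<times> V)"
proof -
  interpret vs_prod: vector_space_prod smul smul ..
  show ?thesis by (rule vs_prod.subspace_Times[OF subspace_A subspace_V])
qed

text \<open>The map sending (a, x) to a + x is an isomorphism from the product on
  \<open>A \<times> V\<close> to \<open>unified_structure\<close>, so the Jordan laws transfer in
  both directions; agreement with \<open>mA\<close> on \<open>A\<close> follows from bilinearity of
  the datum. From here on all arguments take place in E.\<close>

lemma JES_iff:
  "\<Omega> \<in> JES smul A mA V \<longleftrightarrow>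
     extending_datum smul A V \<Omega> \<and> unified_structure A mA V \<Omega> \<in> jordan_structures smul A mA"
proof (cases "extending_datum smul A V \<Omega>")
  case True
  have "jordan_algebra_on smul UNIV (unified_structure A mA V \<Omega>)"
    if "jordan_algebra_on (module_prod.scale smul smul) (A \<times> V) (unified_mult mA \<Omega>)"
  proof (rule jordan_algebra_on_transport[OF that, where h = "\<lambda>(a, x). a + x"])
    show "(\<lambda>(a, x). a + x) ` (A \<times> V) = UNIV"
      using decompose by (auto simp: image_iff) metis
    show "vector_space smul" ..
    show "subspace UNIV" by simp
  next
    fix p q assume "p \<in> A \<times> V" "q \<in> A \<times> V"
    then show "unified_structure A mA V \<Omega> (case p of (a, x) \<Rightarrow> a + x) (case q of (a, x) \<Rightarrow> a + x) =
        (case unified_mult mA \<Omega> p q of (a, x) \<Rightarrow> a + x)"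
      by (auto simp: unified_structure_sum unified_mult_def)
  qed (auto simp: prod_scale scale_right_distrib)
  moreover have "jordan_algebra_on (module_prod.scale smul smul) (A \<times> V) (unified_mult mA \<Omega>)"
    if "jordan_algebra_on smul UNIV (unified_structure A mA V \<Omega>)"
  proof (rule jordan_algebra_on_transport[OF that, where h = "\<lambda>e. (projA e, projV e)"])
    show "range (\<lambda>e. (projA e, projV e)) = A \<times> V"
      by (auto simp: proj_in image_iff) (metis proj_sum)
    show "vector_space (module_prod.scale smul smul)" by (rule vector_space_prod_scale)
    show "module.subspace (module_prod.scale smul smul) (A \<times> V)" by (rule subspace_prod)
  next
    fix d e
    \<comment> \<open>\<open>unified_structure_sum\<close> needs arguments that are visibly sums, so
      \<open>d\<close> and \<open>e\<close> are first expanded into their components and recombined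
      afterwards.\<close>
    have "unified_mult mA \<Omega> (projA d, projV d) (projA e, projV e) =
        (projA (unified_structure A mA V \<Omega> (projA d + projV d) (projA e + projV e)),
         projV (unified_structure A mA V \<Omega> (projA d + projV d) (projA e + projV e)))"
      using True by (simp add: unified_structure_sum proj_in unified_mult_def proj_sum closed datum_in mA_in)
    then show "unified_mult mA \<Omega> (projA d, projV d) (projA e, projV e) =
        (projA (unified_structure A mA V \<Omega> d e), projV (unified_structure A mA V \<Omega> d e))"
      by (simp only: proj_decomp)
  qed (auto simp: prod_scale proj_add proj_scale)
  ultimately show ?thesis
    using True by (auto simp: JES_def jordan_structures_def unified_structure_A)
qed (simp add: JES_def)

text \<open>The datum consists of the components of \<open>m\<close> on \<open>V \<times> A\<close>
  and on \<open>V \<times> V\<close>; the values on \<open>A \<times> A\<close> are prescribed, and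
  those on \<open>A \<times> V\<close> follow by commutativity.\<close>

lemma unified_structure_surj:
  assumes m: "m \<in> jordan_structures smul A mA"
  obtains \<Omega> where "\<Omega> \<in> JES smul A mA V" "unified_structure A mA V \<Omega> = m"
proof -
  have bil: "bilinear_on smul UNIV UNIV UNIV m"
    and comm: "\<And>a b. m a b = m b a"
    and mA_eq: "\<And>a b. a \<in> A \<Longrightarrow> b \<in> A \<Longrightarrow> m a b = mA a b"
    using m by (auto simp: jordan_structures_def jordan_algebra_on_def)
  note b = bilinear_onD[OF bil, simplified]
  \<comment> \<open>The restricted abstractions give the value \<open>undefined\<close> off the
    domains, as \<open>extending_datum\<close> demands.\<close>
  define \<Omega> where "\<Omega> = \<lparr>ract = (\<lambda>x\<in>V. \<lambda>a\<in>A. projV (m x a)), lact = (\<lambda>x\<in>V. \<lambda>a\<in>A. projA (m x a)),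
    cocycle = (\<lambda>x\<in>V. \<lambda>y\<in>V. projA (m x y)), vmult = (\<lambda>x\<in>V. \<lambda>y\<in>V. projV (m x y))\<rparr>"
  have dat: "extending_datum smul A V \<Omega>"
    unfolding extending_datum_def
    by (intro conjI bilinear_onI) (auto simp: \<Omega>_def b proj_add proj_scale closed proj_in)
  have eq: "unified_structure A mA V \<Omega> = m"
  proof (intro ext)
    fix d e
    obtain a x where ax: "a \<in> A" "x \<in> V" "d = a + x" by (rule decompose)
    obtain b' y where b_y: "b' \<in> A" "y \<in> V" "e = b' + y" by (rule decompose)
    have "unified_structure A mA V \<Omega> d e =
      mA a b' + (projA (m x b') + projV (m x b')) + (projA (m y a) + projV (m y a))
        + (projA (m x y) + projV (m x y))"
      using ax b_y by (simp add: unified_structure_sum \<Omega>_def algebra_simps)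
    \<comment> \<open>Each pair of projections adds up to a value of \<open>m\<close>. Expanding
      \<open>m d e\<close> yields \<open>m a y\<close>, whereas the datum records
      \<open>m y a\<close>.\<close>
    also have "\<dots> = m d e"
      using ax b_y comm[of y a] by (simp add: proj_decomp b mA_eq algebra_simps)
    finally show "unified_structure A mA V \<Omega> d e = m d e" .
  qed
  show thesis using that[of \<Omega>] dat eq m by (simp add: JES_iff)
qed

section \<open>Equivalences of data versus isomorphisms fixing A\<close>

lemma datum_equiv_imp_isomorphism:
  assumes dat: "extending_datum smul A V \<Omega>" "extending_datum smul A V \<Omega>'"
    and equ: "datum_equiv smul A mA V \<Omega> \<Omega>'"
  obtains \<phi> where
    "jordan_isomorphism smul (unified_structure A mA V \<Omega>) (unified_structure A mA V \<Omega>') \<phi>"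
    "\<And>a. a \<in> A \<Longrightarrow> \<phi> a = a"
proof -
  obtain r v where r: "linear_on smul V A r" and v: "linear_on smul V V v" and bij: "bij_betw v V V"
    and eqs: "\<forall>a\<in>A. \<forall>x\<in>V. \<forall>y\<in>V.
          let x' = inv_into V v x; y' = inv_into V v y in
            ract \<Omega>' x a = v (ract \<Omega> x' a) \<and>
            lact \<Omega>' x a = r (ract \<Omega> x' a) + lact \<Omega> x' a - mA a (r x') \<and>
            cocycle \<Omega>' x y =
              cocycle \<Omega> x' y' + r (vmult \<Omega> x' y') + mA (r x') (r y')
                - r (ract \<Omega> x' (r y')) - lact \<Omega> x' (r y')
                - r (ract \<Omega> y' (r x')) - lact \<Omega> y' (r x') \<and>
            vmult \<Omega>' x y =
              v (vmult \<Omega> x' y') - v (ract \<Omega> x' (r y')) - v (ract \<Omega> y' (r x'))"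
    using equ unfolding datum_equiv_def by blast
  note r' = linear_onD[OF r] and v' = linear_onD[OF v]
  have inv: "inv_into V v (v x) = x" if "x \<in> V" for x
    using bij that by (simp add: bij_betw_inv_into_left)
  \<comment> \<open>Replacing \<open>x\<close> and \<open>y\<close> by their images under
    \<open>v\<close> removes the inverse of \<open>v\<close> from the identities.\<close>
  have e1: "ract \<Omega>' (v x) a = v (ract \<Omega> x a)"
    and e2: "lact \<Omega>' (v x) a = r (ract \<Omega> x a) + lact \<Omega> x a - mA a (r x)"
    if "a \<in> A" "x \<in> V" for a x
    using eqs[rule_format, of a "v x" "v x"] that by (simp_all add: v' inv)
  have e3: "cocycle \<Omega>' (v x) (v y) = cocycle \<Omega> x y + r (vmult \<Omega> x y) + mA (r x) (r y)
                - r (ract \<Omega> x (r y)) - lact \<Omega> x (r y) - r (ract \<Omega> y (r x)) - lact \<Omega> y (r x)"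
    and e4: "vmult \<Omega>' (v x) (v y) = v (vmult \<Omega> x y) - v (ract \<Omega> x (r y)) - v (ract \<Omega> y (r x))"
    if "x \<in> V" "y \<in> V" for x y
    \<comment> \<open>These two identities do not involve the element of \<open>A\<close>; 0 merely
      instantiates the quantifier.\<close>
    using eqs[rule_format, of 0 "v x" "v y"] that by (simp_all add: v' inv closed)
  define \<phi> where "\<phi> e = projA e + r (projV e) + v (projV e)" for e
  have \<phi>: "\<phi> (a + x) = (a + r x) + v x" if "a \<in> A" "x \<in> V" for a x
    using that by (simp add: \<phi>_def proj_sum)
  have lin: "Vector_Spaces.linear smul smul \<phi>"
    by unfold_locales
      (simp_all add: \<phi>_def proj_add proj_scale r' v' proj_in scale_right_distrib algebra_simps)
  have bij\<phi>: "bij \<phi>"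
  proof (rule bijI)
    show "inj \<phi>"
    proof (rule injI)
      fix d e assume h: "\<phi> d = \<phi> e"
      obtain a x where ax: "a \<in> A" "x \<in> V" "d = a + x" by (rule decompose)
      obtain b y where b_y: "b \<in> A" "y \<in> V" "e = b + y" by (rule decompose)
      have "a + r x = b + r y" "v x = v y"
        using h ax b_y decomposition_unique[of "a + r x" "v x" "b + r y" "v y"]
        by (auto simp: \<phi> closed r' v')
      then show "d = e"
        using ax b_y inv by (metis add_right_cancel)
    qed
    show "surj \<phi>"
    proof (rule surjI)
      fix e
      \<comment> \<open>A preimage of \<open>e\<close> needs \<open>V\<close>-part \<open>y\<close>
        with \<open>v y = projV e\<close>; its \<open>A\<close>-part is then
        \<open>projA e - r y\<close>, which cancels the contribution of \<open>r\<close>.\<close>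
      define y where "y = inv_into V v (projV e)"
      have y: "y \<in> V" "v y = projV e"
        using bij proj_in[of e] unfolding y_def
        by (auto simp: bij_betw_def inv_into_into f_inv_into_f)
      show "\<phi> (projA e - r (inv_into V v (projV e)) + inv_into V v (projV e)) = e"
        using y by (simp add: \<phi> y_def[symmetric] proj_in r' closed proj_decomp)
    qed
  qed
  have hom: "\<phi> (unified_structure A mA V \<Omega> d e) = unified_structure A mA V \<Omega>' (\<phi> d) (\<phi> e)" for d e
  proof -
    obtain a x where ax: "a \<in> A" "x \<in> V" "d = a + x" by (rule decompose)
    obtain b y where b_y: "b \<in> A" "y \<in> V" "e = b + y" by (rule decompose)
    note [simp] = ax b_y closed datum_in[OF dat(1)] mA_in r' v'
    show ?thesis
      \<comment> \<open>\<open>e1\<close> to \<open>e4\<close> turn all terms of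
        \<open>\<Omega>'\<close> into terms of \<open>\<Omega>\<close>, which additivity then
        expands. Up to commutativity, the mixed products cancel: \<open>mA (r x) (r y)\<close>
        arises twice with each sign, so only \<open>mA a b\<close> is left.\<close>
      using mA_commute[of a "r y"] mA_commute[of b "r x"] mA_commute[of "r y" "r x"]
      by (simp add: unified_structure_sum \<phi> datum_add[OF dat(1)] mA_add
        e1 e2 e3 e4)
  qed
  show thesis
  proof (rule that)
    show "jordan_isomorphism smul (unified_structure A mA V \<Omega>) (unified_structure A mA V \<Omega>') \<phi>"
      using lin bij\<phi> hom by (simp add: jordan_isomorphism_def)
    show "\<phi> a = a" if "a \<in> A" for a
      using \<phi>[OF that, of 0] by (simp add: closed map_zero[OF r] map_zero[OF v])
  qed
qed

text \<open>The pair (r, v) consists of the components of \<open>\<phi>\<close> on \<open>V\<close>.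
  Multiplicativity on \<open>V \<times> A\<close> and on \<open>V \<times> V\<close>, split into
  components, gives the identities once \<open>v\<close> is inverted.\<close>

lemma isomorphism_imp_datum_equiv:
  assumes dat: "extending_datum smul A V \<Omega>" "extending_datum smul A V \<Omega>'"
    and iso: "jordan_isomorphism smul (unified_structure A mA V \<Omega>) (unified_structure A mA V \<Omega>') \<phi>"
    and fix_A: "\<And>a. a \<in> A \<Longrightarrow> \<phi> a = a"
  shows "datum_equiv smul A mA V \<Omega> \<Omega>'"
proof -
  interpret \<phi>: Vector_Spaces.linear smul smul \<phi>
    using iso by (simp add: jordan_isomorphism_def)
  have bij: "bij \<phi>"
    and hom: "\<And>d e. \<phi> (unified_structure A mA V \<Omega> d e) = unified_structure A mA V \<Omega>' (\<phi> d) (\<phi> e)"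
    using iso by (auto simp: jordan_isomorphism_def)
  define r where "r x = projA (\<phi> x)" for x
  define v where "v x = projV (\<phi> x)" for x
  have r: "linear_on smul V A r" and v: "linear_on smul V V v"
    by (auto simp: linear_on_def r_def v_def proj_in proj_add proj_scale \<phi>.add \<phi>.scale)
  note r' = linear_onD[OF r] and v' = linear_onD[OF v]
  have \<phi>: "\<phi> (a + x) = (a + r x) + v x" if "a \<in> A" for a x
    using that by (simp add: \<phi>.add fix_A r_def v_def add.assoc proj_decomp)
  have bijv: "bij_betw v V V"
  proof (rule bij_betw_imageI)
    show "inj_on v V"
    proof (rule inj_onI)
      fix x y assume xy: "x \<in> V" "y \<in> V" "v x = v y"
      \<comment> \<open>If \<open>v x = v y\<close>, the images of \<open>x\<close> and
        \<open>y\<close> differ only in their \<open>A\<close>-parts. Adding these crosswise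
        equalizes the images because \<open>\<phi>\<close> fixes \<open>A\<close>, and injectivity
        of \<open>\<phi>\<close> applies.\<close>
      have "\<phi> (r y + x) = \<phi> (r x + y)"
        using xy \<phi>[of "r y" x] \<phi>[of "r x" y] by (simp only: r' add.commute)
      then have "r y + x = r x + y" using bij by (simp add: bij_def inj_eq)
      then show "x = y" using xy decomposition_unique r' by meson
    qed
    show "v ` V = V"
    proof (intro equalityI subsetI)
      fix y assume y: "y \<in> V"
      obtain e where e: "\<phi> e = y" using bij by (metis bij_pointE)
      obtain a x where ax: "a \<in> A" "x \<in> V" "e = a + x" by (rule decompose)
      then have "(a + r x) + v x = 0 + y" using e \<phi> by simp
      then have "v x = y"
        using decomposition_unique(2)[of "a + r x" "v x" 0 y] ax y by (simp add: r' v' closed)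
      then show "y \<in> v ` V" using ax by blast
    qed (auto simp: v')
  qed
  have cross:
    "r (ract \<Omega> x a) + lact \<Omega> x a = mA a (r x) + lact \<Omega>' (v x) a"
    "v (ract \<Omega> x a) = ract \<Omega>' (v x) a" if "a \<in> A" "x \<in> V" for a x
  proof -
    note [simp] = that closed datum_in[OF dat(1)] datum_in[OF dat(2)] r' v' mA_in
    have "(lact \<Omega> x a + r (ract \<Omega> x a)) + v (ract \<Omega> x a) =
        (mA (r x) a + lact \<Omega>' (v x) a) + ract \<Omega>' (v x) a"
      \<comment> \<open>The zero summands bring elements of \<open>V\<close> and \<open>A\<close>
        into the form that \<open>unified_structure_sum\<close> expects.\<close>
      using hom[of "0 + x" "a + 0"] unified_structure_sum[of 0 x a 0 \<Omega>]
        unified_structure_sum[of "r x" "v x" a 0 \<Omega>']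
        \<phi>[of 0 x] \<phi>[of "lact \<Omega> x a" "ract \<Omega> x a"] fix_A[of a]
      by (simp add: mA_zero datum_zero[OF dat(1)] datum_zero[OF dat(2)])
    from decomposition_unique[OF _ _ _ _ this]
    show "r (ract \<Omega> x a) + lact \<Omega> x a = mA a (r x) + lact \<Omega>' (v x) a"
      "v (ract \<Omega> x a) = ract \<Omega>' (v x) a"
      using mA_commute[of a "r x"] by (simp_all add: add.commute)
  qed
  have square:
    "cocycle \<Omega> x y + r (vmult \<Omega> x y) =
      mA (r x) (r y) + lact \<Omega>' (v x) (r y) + lact \<Omega>' (v y) (r x) + cocycle \<Omega>' (v x) (v y)"
    "v (vmult \<Omega> x y) = ract \<Omega>' (v x) (r y) + ract \<Omega>' (v y) (r x) + vmult \<Omega>' (v x) (v y)"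
    if "x \<in> V" "y \<in> V" for x y
  proof -
    note [simp] = that closed datum_in[OF dat(1)] datum_in[OF dat(2)] r' v' mA_in
    have "(cocycle \<Omega> x y + r (vmult \<Omega> x y)) + v (vmult \<Omega> x y) =
      (mA (r x) (r y) + lact \<Omega>' (v x) (r y) + lact \<Omega>' (v y) (r x) + cocycle \<Omega>' (v x) (v y)) +
      (ract \<Omega>' (v x) (r y) + ract \<Omega>' (v y) (r x) + vmult \<Omega>' (v x) (v y))"
      using hom[of "0 + x" "0 + y"] unified_structure_sum[of 0 x 0 y \<Omega>]
        unified_structure_sum[of "r x" "v x" "r y" "v y" \<Omega>']
        \<phi>[of 0 x] \<phi>[of 0 y] \<phi>[of "cocycle \<Omega> x y" "vmult \<Omega> x y"]
      by (simp add: mA_zero datum_zero[OF dat(1)])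
    from decomposition_unique[OF _ _ _ _ this]
    show "cocycle \<Omega> x y + r (vmult \<Omega> x y) =
      mA (r x) (r y) + lact \<Omega>' (v x) (r y) + lact \<Omega>' (v y) (r x) + cocycle \<Omega>' (v x) (v y)"
      "v (vmult \<Omega> x y) = ract \<Omega>' (v x) (r y) + ract \<Omega>' (v y) (r x) + vmult \<Omega>' (v x) (v y)"
      by simp_all
  qed
  have "let x' = inv_into V v x; y' = inv_into V v y in
            ract \<Omega>' x a = v (ract \<Omega> x' a) \<and>
            lact \<Omega>' x a = r (ract \<Omega> x' a) + lact \<Omega> x' a - mA a (r x') \<and>
            cocycle \<Omega>' x y =
              cocycle \<Omega> x' y' + r (vmult \<Omega> x' y') + mA (r x') (r y')
                - r (ract \<Omega> x' (r y')) - lact \<Omega> x' (r y')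
                - r (ract \<Omega> y' (r x')) - lact \<Omega> y' (r x') \<and>
            vmult \<Omega>' x y =
              v (vmult \<Omega> x' y') - v (ract \<Omega> x' (r y')) - v (ract \<Omega> y' (r x'))"
    if a: "a \<in> A" and x: "x \<in> V" and y: "y \<in> V" for a x y
  proof -
    define x' where "x' = inv_into V v x"
    define y' where "y' = inv_into V v y"
    have x': "x' \<in> V" "v x' = x" and y': "y' \<in> V" "v y' = y"
      using bijv x y unfolding x'_def y'_def
      by (auto simp: bij_betw_def inv_into_into f_inv_into_f)
    \<comment> \<open>Stated for every \<open>b\<close> in \<open>A\<close>, since it is used at
      \<open>a\<close> and also at \<open>r x'\<close> and \<open>r y'\<close>.\<close>
    have c: "lact \<Omega>' x b = r (ract \<Omega> x' b) + lact \<Omega> x' b - mA b (r x')"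
      "lact \<Omega>' y b = r (ract \<Omega> y' b) + lact \<Omega> y' b - mA b (r y')" if "b \<in> A" for b
      using cross(1)[OF that x'(1)] cross(1)[OF that y'(1)] by (simp_all add: x' y')
    have coc: "cocycle \<Omega>' x y = cocycle \<Omega> x' y' + r (vmult \<Omega> x' y')
        - mA (r x') (r y') - lact \<Omega>' x (r y') - lact \<Omega>' y (r x')"
      using square(1)[OF x'(1) y'(1)] by (simp add: x' y')
    have "cocycle \<Omega>' x y =
              cocycle \<Omega> x' y' + r (vmult \<Omega> x' y') + mA (r x') (r y')
                - r (ract \<Omega> x' (r y')) - lact \<Omega> x' (r y')
                - r (ract \<Omega> y' (r x')) - lact \<Omega> y' (r x')"
      \<comment> \<open>Substituting \<open>c\<close> for the two \<open>lact \<Omega>'\<close>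
        terms adds \<open>mA (r x') (r y')\<close> twice, which turns its sign in \<open>coc\<close>
        from minus to plus.\<close>
      unfolding coc using mA_commute[of "r x'" "r y'"]
      by (simp add: c r' x' y')
    moreover have "vmult \<Omega>' x y =
              v (vmult \<Omega> x' y') - v (ract \<Omega> x' (r y')) - v (ract \<Omega> y' (r x'))"
      using square(2)[OF x'(1) y'(1)] by (simp add: x' y' r' cross)
    moreover have "ract \<Omega>' x a = v (ract \<Omega> x' a)" using cross(2)[OF a x'(1)] x' by simp
    ultimately show ?thesis
      using c(1)[OF a] unfolding Let_def x'_def[symmetric] y'_def[symmetric] by blast
  qed
  then show ?thesis unfolding datum_equiv_def using r v bijv by blast
qed

section \<open>Comparison of the two relations and the induced bijection\<close>

lemma JES_rel_eq_pullback:
  "JES_rel smul A mA V = {(\<Omega>, \<Omega>'). \<Omega> \<in> JES smul A mA V \<and> \<Omega>' \<in> JES smul A mA V \<and>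
     (unified_structure A mA V \<Omega>, unified_structure A mA V \<Omega>') \<in> Jext_rel smul A mA}"
proof -
  have "datum_equiv smul A mA V \<Omega> \<Omega>' \<longleftrightarrow>
      (unified_structure A mA V \<Omega>, unified_structure A mA V \<Omega>') \<in> Jext_rel smul A mA"
    if "\<Omega> \<in> JES smul A mA V" "\<Omega>' \<in> JES smul A mA V" for \<Omega> \<Omega>'
  proof -
    have dat: "extending_datum smul A V \<Omega>" "extending_datum smul A V \<Omega>'"
      and str: "unified_structure A mA V \<Omega> \<in> jordan_structures smul A mA"
        "unified_structure A mA V \<Omega>' \<in> jordan_structures smul A mA"
      using that by (simp_all add: JES_iff)
    have "datum_equiv smul A mA V \<Omega> \<Omega>' \<longleftrightarrow> (\<exists>\<phi>. jordan_isomorphism smul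
        (unified_structure A mA V \<Omega>) (unified_structure A mA V \<Omega>') \<phi> \<and> (\<forall>a\<in>A. \<phi> a = a))"
      using datum_equiv_imp_isomorphism[OF dat] isomorphism_imp_datum_equiv[OF dat] by metis
    then show ?thesis using str by (simp add: Jext_rel_def)
  qed
  then show ?thesis by (auto simp: JES_rel_def)
qed

lemma equiv_Jext_rel: "equiv (jordan_structures smul A mA) (Jext_rel smul A mA)"
proof (rule equivI)
  show "Jext_rel smul A mA \<subseteq> jordan_structures smul A mA \<times> jordan_structures smul A mA"
    by (auto simp: Jext_rel_def)
  have "jordan_isomorphism smul m m id" for m
    by (simp add: jordan_isomorphism_def linear_id)
  then show "refl_on (jordan_structures smul A mA) (Jext_rel smul A mA)"
    by (auto simp: refl_on_def Jext_rel_def intro!: exI[of _ id])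
  have "jordan_isomorphism smul m' m (inv \<phi>) \<and> (\<forall>a\<in>A. inv \<phi> a = a)"
    if iso: "jordan_isomorphism smul m m' \<phi>" and fix_A: "\<forall>a\<in>A. \<phi> a = a" for m m' \<phi>
  proof -
    interpret \<phi>: Vector_Spaces.linear smul smul \<phi>
      using iso by (simp add: jordan_isomorphism_def)
    have bij: "bij \<phi>" and hom: "\<And>x y. \<phi> (m x y) = m' (\<phi> x) (\<phi> y)"
      using iso by (auto simp: jordan_isomorphism_def)
    have r: "\<phi> (inv \<phi> x) = x" for x using bij by (simp add: bij_is_surj surj_f_inv_f)
    \<comment> \<open>As a rewrite rule this reduces each claim about the inverse to the
      corresponding property of \<open>\<phi>\<close>.\<close>
    have l: "inv \<phi> x = y \<longleftrightarrow> x = \<phi> y" for x y using bij r by (metis bij_inv_eq_iff)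
    have "Vector_Spaces.linear smul smul (inv \<phi>)"
      by unfold_locales (simp_all add: l \<phi>.add \<phi>.scale r)
    then show ?thesis
      using bij fix_A by (simp add: jordan_isomorphism_def bij_imp_bij_inv l hom r)
  qed
  then show "sym (Jext_rel smul A mA)"
    unfolding sym_def Jext_rel_def by blast
  have "jordan_isomorphism smul m m'' (\<psi> \<circ> \<phi>) \<and> (\<forall>a\<in>A. (\<psi> \<circ> \<phi>) a = a)"
    if "jordan_isomorphism smul m m' \<phi>" "jordan_isomorphism smul m' m'' \<psi>"
      "\<forall>a\<in>A. \<phi> a = a" "\<forall>a\<in>A. \<psi> a = a" for m m' m'' \<phi> \<psi>
    using that by (auto simp: jordan_isomorphism_def intro: bij_comp Vector_Spaces.linear_compose)
  then show "trans (Jext_rel smul A mA)"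
    unfolding trans_def Jext_rel_def
    by clarify blast
qed

lemma unified_structure_image:
  "unified_structure A mA V ` JES smul A mA V = jordan_structures smul A mA"
proof (intro equalityI subsetI)
  fix m assume "m \<in> jordan_structures smul A mA"
  then show "m \<in> unified_structure A mA V ` JES smul A mA V"
    by (rule unified_structure_surj) blast
qed (auto simp: JES_iff)

end

theorem theorem2p10:
  fixes smul :: "'k::field \<Rightarrow> 'e::ab_group_add \<Rightarrow> 'e"
    and A V :: "'e set"
    and mA :: "'e \<Rightarrow> 'e \<Rightarrow> 'e"
  assumes "CHAR('k) \<noteq> 2"
    and "vector_space smul"
    and "jordan_algebra_on smul A mA"
    and "complementary smul A V"
  shows "equiv (JES smul A mA V) (JES_rel smul A mA V)
     \<and> (\<forall>\<Omega>\<in>JES smul A mA V. unified_structure A mA V \<Omega> \<in> jordan_structures smul A mA)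
     \<and> (unified_class smul A mA V) respects (JES_rel smul A mA V)
     \<and> (\<forall>\<Omega>\<in>JES smul A mA V.
           JES_to_Jext smul A mA V (JES_rel smul A mA V `` {\<Omega>}) = unified_class smul A mA V \<Omega>)
     \<and> bij_betw (JES_to_Jext smul A mA V) (JES_quotient smul A mA V) (Jext smul A mA)"
proof -
  interpret jordan_complement smul A V mA
    using assms by (simp add: jordan_complement_def jordan_complement_axioms_def)
  \<comment> \<open>\<open>unified_class\<close> and \<open>JES_to_Jext\<close> are brought into the
    literal form of the conclusions of the pullback lemma, with \<open>unified_structure\<close> as
    the surjection.\<close>
  have cls: "unified_class smul A mA V =
      (\<lambda>\<Omega>. Jext_rel smul A mA `` {unified_structure A mA V \<Omega>})"
    by (simp add: fun_eq_iff unified_class_def)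
  have map: "JES_to_Jext smul A mA V =
      (\<lambda>C. the_elem ((\<lambda>\<Omega>. Jext_rel smul A mA `` {unified_structure A mA V \<Omega>}) ` C))"
    by (simp add: fun_eq_iff JES_to_Jext_def cls)
  note pb = bij_betw_quotient_pullback[OF equiv_Jext_rel unified_structure_image JES_rel_eq_pullback]
  show ?thesis
    unfolding cls map JES_quotient_def Jext_def
  proof (intro conjI ballI)
    show "unified_structure A mA V \<Omega> \<in> jordan_structures smul A mA"
      if "\<Omega> \<in> JES smul A mA V" for \<Omega>
      using that by (simp add: JES_iff)
  qed (fact pb | erule pb)+
qed

end
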